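(* Let $K$ be a field of characteristic $p>0$, $n\geq 1$, and $P_n=K[x_1,\ldots,x_n]$ the polynomial algebra. Then there is an isomorphism of groups $\mathrm{Aut}_{ord}(\mathcal{D}(P_n))\simeq\mathrm{Aut}_K(P_n)$.
   Context: $\mathbb{N}=\{0,1,\ldots\}$. $\mathcal{D}(P_n)\subseteq\mathrm{End}_K(P_n)$ is the ring of $K$-linear differential operators on $P_n$. One has $\mathcal{D}(P_n)=\bigoplus_{\alpha\in\mathbb{N}^n}P_n\partial^{[\alpha]}$, where $\partial^{[\alpha]}=\prod_{i=1}^n\frac{\partial_i^{\alpha_i}}{\alpha_i!}$ is the $K$-linear operator with $\partial^{[\alpha]}(x^\beta)=\prod_i\binom{\beta_i}{\alpha_i}x^{\beta-\alpha}$ for $\beta\in\mathbb{N}^n$ (zero if some $\beta_i<\alpha_i$), and elements of $P_n$ act by multiplication. The order filtration is $\mathcal{D}(P_n)_i=\bigoplus_{|\alpha|\leq i}P_n\partial^{[\alpha]}$, $i\geq 0$, where $|\alpha|=\alpha_1+\cdots+\alpha_n$. $\mathrm{Aut}_K$ denotes the group of $K$-algebra automorphisms, and $$\mathrm{Aut}_{ord}(\mathcal{D}(P_n))=\{\sigma\in\mathrm{Aut}_K(\mathcal{D}(P_n)) \mid \sigma(\mathcal{D}(P_n)_i)=\mathcal{D}(P_n)_i,\ i\geq 0\}.$$ *)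

theory Defs
  imports "HOL-Algebra.Algebra" "HOL-Library.Poly_Mapping"
begin

text \<open>
  The variables of the polynomial ring \<open>P\<^sub>n = K[x\<^sub>1,\<dots>,x\<^sub>n]\<close> are indexed by a finite type
  \<open>'n\<close>; \<open>n\<close> is its cardinality, and \<open>n \<ge> 1\<close> since types are nonempty.
  A polynomial maps each exponent vector \<open>\<beta>\<close> to the coefficient of \<open>x\<^sup>\<beta>\<close>.
\<close>

type_synonym ('n, 'k) mpoly = "('n \<Rightarrow>\<^sub>0 nat) \<Rightarrow>\<^sub>0 'k"

definition pscale :: "'k::field \<Rightarrow> ('n, 'k) mpoly \<Rightarrow> ('n, 'k) mpoly" where
  "pscale c f = Poly_Mapping.single 0 c * f"

lemma vector_space_pscale: "vector_space (pscale :: 'k::field \<Rightarrow> ('n, 'k) mpoly \<Rightarrow> _)"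
  by unfold_locales
    (simp_all add: pscale_def algebra_simps single_add mult_single flip: mult.assoc)

definition poly_algebra ::
  "'n::finite itself \<Rightarrow> 'k::field itself \<Rightarrow> ('k, ('n, 'k) mpoly) module" where
  "poly_algebra _ _ = \<lparr>carrier = UNIV, monoid.mult = (*), one = 1, ring.zero = 0, add = (+), smult = pscale\<rparr>"


section \<open>Differential operators\<close>

text \<open>
  Differential operators in the sense of Grothendieck: with \<open>\<D>\<^sub>-\<^sub>1 = 0\<close>, an endomorphism \<open>f\<close> in
  \<open>End\<^sub>K(P\<^sub>n)\<close> has order at most \<open>i\<close> if \<open>[f, r]\<close> has order at most \<open>i - 1\<close> for
  every \<open>r\<close> in \<open>P\<^sub>n\<close>, where \<open>r\<close> acts by multiplication.
\<close>

definition mult_commutator ::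
  "(('n::finite, 'k::field) mpoly \<Rightarrow> ('n, 'k) mpoly) \<Rightarrow> ('n, 'k) mpoly \<Rightarrow> ('n, 'k) mpoly \<Rightarrow> ('n, 'k) mpoly" where
  "mult_commutator f r = (\<lambda>g. f (r * g) - r * f g)"

primrec diff_ops_upto :: "nat \<Rightarrow> (('n::finite, 'k::field) mpoly \<Rightarrow> ('n, 'k) mpoly) set" where
  "diff_ops_upto 0 =
     {f. Vector_Spaces.linear pscale pscale f \<and> (\<forall>r. mult_commutator f r = (\<lambda>_. 0))}"
| "diff_ops_upto (Suc i) =
     {f. Vector_Spaces.linear pscale pscale f \<and> (\<forall>r. mult_commutator f r \<in> diff_ops_upto i)}"

definition diff_ops :: "(('n::finite, 'k::field) mpoly \<Rightarrow> ('n, 'k) mpoly) set" where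
  "diff_ops = (\<Union>i. diff_ops_upto i)"

definition diff_op_algebra ::
  "'n::finite itself \<Rightarrow> 'k::field itself \<Rightarrow> ('k, ('n, 'k) mpoly \<Rightarrow> ('n, 'k) mpoly) module" where
  "diff_op_algebra _ _ =
     \<lparr>carrier = diff_ops, monoid.mult = (\<circ>), one = id,
      ring.zero = (\<lambda>_. 0), add = (\<lambda>f g x. f x + g x), smult = (\<lambda>c f x. pscale c (f x))\<rparr>"

lemma ring_poly_algebra: "ring (poly_algebra TYPE('n::finite) TYPE('k::field))"
proof (rule ringI)
  show "abelian_group (poly_algebra TYPE('n) TYPE('k))"
  proof (rule abelian_groupI)
    show "\<exists>y\<in>carrier (poly_algebra TYPE('n) TYPE('k)).
        y \<oplus>\<^bsub>poly_algebra TYPE('n) TYPE('k)\<^esub> x = \<zero>\<^bsub>poly_algebra TYPE('n) TYPE('k)\<^esub>" for x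
      by (rule bexI[of _ "- x"]) (simp_all add: poly_algebra_def)
  qed (simp_all add: poly_algebra_def algebra_simps)
  show "monoid (poly_algebra TYPE('n) TYPE('k))"
    by (rule monoidI) (simp_all add: poly_algebra_def algebra_simps)
qed (simp_all add: poly_algebra_def algebra_simps)

lemma linear_pscale_iff:
  "Vector_Spaces.linear pscale pscale f \<longleftrightarrow>
     (\<forall>x y. f (x + y) = f x + f y) \<and> (\<forall>c x. f (pscale c x) = pscale c (f x))"
  by (auto simp: vector_space_pscale Vector_Spaces.linear_def Modules.module_hom_def Modules.module_hom_axioms_def
      module_iff_vector_space)

lemma pscale_simps:
  "pscale c (x + y) = pscale c x + pscale c y" "pscale c (x - y) = pscale c x - pscale c y"
  "pscale c (r * x) = r * pscale c x" "pscale c (pscale d x) = pscale (c * d) x"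
  "pscale c 0 = 0" "pscale 1 x = x" "pscale (- 1) x = - x"
  by (simp_all add: pscale_def algebra_simps mult_single single_uminus flip: mult.assoc)

lemma diff_ops_upto_linear: "f \<in> diff_ops_upto i \<Longrightarrow> Vector_Spaces.linear pscale pscale f"
  by (cases i) auto

lemma zero_diff_ops_upto: "(\<lambda>_. 0) \<in> diff_ops_upto i"
  by (induction i) (auto simp: linear_pscale_iff mult_commutator_def pscale_simps)

lemma id_diff_ops: "id \<in> diff_ops"
  by (auto simp: diff_ops_def linear_pscale_iff mult_commutator_def intro!: exI[of _ 0])

lemma diff_ops_upto_Suc: "f \<in> diff_ops_upto i \<Longrightarrow> f \<in> diff_ops_upto (Suc i)"
proof (induction i arbitrary: f)
  case 0
  then have "mult_commutator f r \<in> diff_ops_upto 0" for r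
    using zero_diff_ops_upto[of 0] by simp
  with 0 show ?case by simp
qed auto

lemma diff_ops_upto_mono: "i \<le> j \<Longrightarrow> f \<in> diff_ops_upto i \<Longrightarrow> f \<in> diff_ops_upto j"
  by (induction j rule: dec_induct) (auto intro: diff_ops_upto_Suc simp del: diff_ops_upto.simps)

lemma diff_ops_upto_add:
  "f \<in> diff_ops_upto i \<Longrightarrow> g \<in> diff_ops_upto i \<Longrightarrow> (\<lambda>x. f x + g x) \<in> diff_ops_upto i"
proof (induction i arbitrary: f g)
  case 0
  then show ?case
    by (auto simp: linear_pscale_iff mult_commutator_def pscale_simps fun_eq_iff algebra_simps)
next
  case (Suc i)
  have eq: "mult_commutator (\<lambda>x. f x + g x) r =
      (\<lambda>x. mult_commutator f r x + mult_commutator g r x)" for r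
    by (simp add: mult_commutator_def fun_eq_iff algebra_simps)
  show ?case
    using Suc.prems Suc.IH[of "mult_commutator f _" "mult_commutator g _"]
    by (auto simp: eq linear_pscale_iff pscale_simps)
qed

lemma diff_ops_upto_pscale: "f \<in> diff_ops_upto i \<Longrightarrow> (\<lambda>x. pscale c (f x)) \<in> diff_ops_upto i"
proof (induction i arbitrary: f)
  case 0
  then show ?case
    by (auto simp: linear_pscale_iff mult_commutator_def pscale_simps fun_eq_iff mult.commute)
next
  case (Suc i)
  have "mult_commutator (\<lambda>x. pscale c (f x)) r = (\<lambda>x. pscale c (mult_commutator f r x))" for r
    by (simp add: mult_commutator_def fun_eq_iff pscale_simps)
  with Suc show ?case
    by (auto simp: linear_pscale_iff pscale_simps mult.commute)
qed

lemma diff_ops_upto_comp: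
  "f \<in> diff_ops_upto i \<Longrightarrow> g \<in> diff_ops_upto j \<Longrightarrow> f \<circ> g \<in> diff_ops_upto (i + j)"
proof (induction "i + j" arbitrary: f g i j)
  case 0
  then show ?case
    by (auto simp: linear_pscale_iff mult_commutator_def fun_eq_iff)
next
  case (Suc k)
  note lin = Suc.prems[THEN diff_ops_upto_linear, unfolded linear_pscale_iff]
  have f_diff: "f (a - b) = f a - f b" for a b
    using lin(1) by (metis add_diff_cancel diff_add_cancel)
  have f0: "f 0 = 0" using f_diff[of 0 0] by simp
  have eq: "mult_commutator (f \<circ> g) r =
      (\<lambda>x. (f \<circ> mult_commutator g r) x + (mult_commutator f r \<circ> g) x)" for r
    by (simp add: mult_commutator_def fun_eq_iff f_diff)
  have "f \<circ> mult_commutator g r \<in> diff_ops_upto k" for r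
  proof (cases j)
    case 0
    with Suc.prems(2) have "mult_commutator g r = (\<lambda>_. 0)" by simp
    then show ?thesis using f0 zero_diff_ops_upto by (simp add: comp_def)
  next
    case j: (Suc j')
    then show ?thesis using Suc.prems Suc.hyps(1)[of i j'] Suc.hyps(2) by simp
  qed
  moreover have "mult_commutator f r \<circ> g \<in> diff_ops_upto k" for r
  proof (cases i)
    case 0
    with Suc.prems(1) have "mult_commutator f r = (\<lambda>_. 0)" by simp
    then show ?thesis using zero_diff_ops_upto by (simp add: comp_def)
  next
    case i: (Suc i')
    then show ?thesis using Suc.prems Suc.hyps(1)[of i' j] Suc.hyps(2) by simp
  qed
  ultimately have "mult_commutator (f \<circ> g) r \<in> diff_ops_upto k" for r
    unfolding eq by (rule diff_ops_upto_add)
  then show ?case using lin by (simp flip: Suc.hyps(2) add: linear_pscale_iff)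
qed

lemma diff_ops_linear: "f \<in> diff_ops \<Longrightarrow> Vector_Spaces.linear pscale pscale f"
  by (auto simp: diff_ops_def intro: diff_ops_upto_linear)

lemma diff_ops_add: "f \<in> diff_ops \<Longrightarrow> g \<in> diff_ops \<Longrightarrow> (\<lambda>x. f x + g x) \<in> diff_ops"
  unfolding diff_ops_def
  by (blast intro: diff_ops_upto_add diff_ops_upto_mono[OF max.cobounded1]
      diff_ops_upto_mono[OF max.cobounded2])

lemma diff_ops_pscale: "f \<in> diff_ops \<Longrightarrow> (\<lambda>x. pscale c (f x)) \<in> diff_ops"
  unfolding diff_ops_def by (blast intro: diff_ops_upto_pscale)

lemma diff_ops_comp: "f \<in> diff_ops \<Longrightarrow> g \<in> diff_ops \<Longrightarrow> f \<circ> g \<in> diff_ops"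
  unfolding diff_ops_def by (blast intro: diff_ops_upto_comp)

lemma zero_diff_ops: "(\<lambda>_. 0) \<in> diff_ops"
  unfolding diff_ops_def using zero_diff_ops_upto by blast

lemma ring_diff_op_algebra: "ring (diff_op_algebra TYPE('n::finite) TYPE('k::field))"
proof (rule ringI)
  show "abelian_group (diff_op_algebra TYPE('n) TYPE('k))"
  proof (rule abelian_groupI)
    fix f assume "f \<in> carrier (diff_op_algebra TYPE('n) TYPE('k))"
    then show "\<exists>g\<in>carrier (diff_op_algebra TYPE('n) TYPE('k)).
        g \<oplus>\<^bsub>diff_op_algebra TYPE('n) TYPE('k)\<^esub> f = \<zero>\<^bsub>diff_op_algebra TYPE('n) TYPE('k)\<^esub>"
      using diff_ops_pscale[of f "- 1"]
      by (intro bexI[of _ "\<lambda>x. pscale (- 1) (f x)"])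
        (simp_all add: diff_op_algebra_def pscale_simps)
  qed (auto simp: diff_op_algebra_def algebra_simps diff_ops_add zero_diff_ops)
  show "monoid (diff_op_algebra TYPE('n) TYPE('k))"
    by (rule monoidI) (auto simp: diff_op_algebra_def diff_ops_comp id_diff_ops o_assoc)
qed (auto simp: diff_op_algebra_def fun_eq_iff dest!: diff_ops_linear simp: linear_pscale_iff)


section \<open>The order filtration\<close>

definition total_degree :: "('n::finite \<Rightarrow>\<^sub>0 nat) \<Rightarrow> nat" where
  "total_degree \<alpha> = (\<Sum>i\<in>UNIV. Poly_Mapping.lookup \<alpha> i)"

definition mbinom :: "('n::finite \<Rightarrow>\<^sub>0 nat) \<Rightarrow> ('n \<Rightarrow>\<^sub>0 nat) \<Rightarrow> nat" where
  "mbinom \<beta> \<alpha> = (\<Prod>i\<in>UNIV. Poly_Mapping.lookup \<beta> i choose Poly_Mapping.lookup \<alpha> i)"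

text \<open>
  The divided power \<open>\<partial>\<^sup>[\<^sup>\<alpha>\<^sup>]\<close>. The subtraction \<open>\<beta> - \<alpha>\<close> is truncated, but
  the binomial coefficient vanishes whenever truncation occurs.
\<close>

definition divided_deriv ::
  "('n::finite \<Rightarrow>\<^sub>0 nat) \<Rightarrow> ('n, 'k::field) mpoly \<Rightarrow> ('n, 'k) mpoly" where
  "divided_deriv \<alpha> f =
     (\<Sum>\<beta>\<in>Poly_Mapping.keys f.
        Poly_Mapping.single (\<beta> - \<alpha>)
          (of_nat (mbinom \<beta> \<alpha>) * Poly_Mapping.lookup f \<beta>))"

lemma divided_deriv_monomial:
  "divided_deriv \<alpha> (Poly_Mapping.single \<beta> (1::'k::field)) =
     Poly_Mapping.single (\<beta> - \<alpha>)
       (of_nat (mbinom \<beta> \<alpha>))"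
  by (simp add: divided_deriv_def)

definition order_filtration :: "nat \<Rightarrow> (('n::finite, 'k::field) mpoly \<Rightarrow> ('n, 'k) mpoly) set" where
  "order_filtration i =
     {(\<lambda>f. \<Sum>\<alpha> | total_degree \<alpha> \<le> i. q \<alpha> * divided_deriv \<alpha> f) |
        q :: ('n \<Rightarrow>\<^sub>0 nat) \<Rightarrow> ('n, 'k) mpoly. True}"

text \<open>The index set of this sum is finite, so the sum is not the default value \<open>0\<close>.\<close>

lemma finite_total_degree_le: "finite {\<alpha> :: 'n::finite \<Rightarrow>\<^sub>0 nat. total_degree \<alpha> \<le> i}"
proof (rule finite_imageD)
  show "inj_on Poly_Mapping.lookup {\<alpha> :: 'n \<Rightarrow>\<^sub>0 nat. total_degree \<alpha> \<le> i}"
    by (auto intro!: inj_onI poly_mapping_eqI)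
  have "Poly_Mapping.lookup \<alpha> j \<le> i" if "total_degree \<alpha> \<le> i" for \<alpha> :: "'n \<Rightarrow>\<^sub>0 nat" and j
    using that member_le_sum[of j UNIV "Poly_Mapping.lookup \<alpha>"] by (simp add: total_degree_def)
  then have "Poly_Mapping.lookup ` {\<alpha> :: 'n \<Rightarrow>\<^sub>0 nat. total_degree \<alpha> \<le> i} \<subseteq> PiE UNIV (\<lambda>_. {..i})"
    by auto
  then show "finite (Poly_Mapping.lookup ` {\<alpha> :: 'n \<Rightarrow>\<^sub>0 nat. total_degree \<alpha> \<le> i})"
    by (rule finite_subset) (simp add: finite_PiE)
qed

lemma mpoly_monomials:
  "(\<Sum>\<beta>\<in>Poly_Mapping.keys f. Poly_Mapping.single \<beta> (Poly_Mapping.lookup f \<beta>)) = f"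
  by (rule poly_mapping_eqI)
    (simp add: lookup_sum lookup_single when_def in_keys_iff if_distrib sum.delta cong: if_cong)

lemma mpoly_add_induct:
  assumes "\<And>\<beta> c. P (Poly_Mapping.single \<beta> c)" and add: "\<And>f g. P f \<Longrightarrow> P g \<Longrightarrow> P (f + g)"
  shows "P (f :: ('n, 'k::field) mpoly)"
proof -
  have "P (\<Sum>\<beta>\<in>B. Poly_Mapping.single \<beta> (Poly_Mapping.lookup f \<beta>))" if "finite B" for B
    using that assms(1)[of 0 0] by induction (auto simp: add assms(1))
  then show ?thesis using mpoly_monomials[of f] by (metis finite_keys)
qed

definition evar :: "'n::finite \<Rightarrow> 'n \<Rightarrow>\<^sub>0 nat" where "evar i = Poly_Mapping.single i 1"
definition pvar :: "'n::finite \<Rightarrow> ('n, 'k::field) mpoly" where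
  "pvar i = Poly_Mapping.single (evar i) 1"

lemma lookup_evar: "Poly_Mapping.lookup (evar i) j = (if i = j then 1 else 0)"
  by (simp add: evar_def lookup_single when_def)

lemma total_degree_add: "total_degree (a + b) = total_degree a + total_degree b"
  by (simp add: total_degree_def lookup_add sum.distrib)

lemma total_degree_evar [simp]: "total_degree (evar i) = 1"
  by (simp add: total_degree_def lookup_evar)

lemma exp_split:
  assumes "Poly_Mapping.lookup b i > 0" shows "b = evar i + (b - evar i)"
  using assms by (intro poly_mapping_eqI) (auto simp: lookup_add lookup_minus lookup_evar)

lemma exp_cases:
  obtains "b = 0" | i where "Poly_Mapping.lookup (b :: 'n::finite \<Rightarrow>\<^sub>0 nat) i > 0"
  by (metis gr0I lookup_zero poly_mapping_eqI)

lemma mpoly_induct [case_names const add var]: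
  fixes f :: "('n::finite, 'k::field) mpoly"
  assumes const: "\<And>c. P (Poly_Mapping.single 0 c)"
    and add: "\<And>f g. P f \<Longrightarrow> P g \<Longrightarrow> P (f + g)"
    and var: "\<And>i f. P f \<Longrightarrow> P (pvar i * f)"
  shows "P f"
proof (rule mpoly_add_induct)
  fix \<beta> :: "'n \<Rightarrow>\<^sub>0 nat" and c :: 'k
  show "P (Poly_Mapping.single \<beta> c)"
  proof (induction "total_degree \<beta>" arbitrary: \<beta> rule: less_induct)
    case less
    show ?case
    proof (cases \<beta> rule: exp_cases)
      case (2 i)
      note e = exp_split[OF 2]
      have "total_degree (\<beta> - evar i) < total_degree \<beta>"
        by (subst (2) e) (simp add: total_degree_add)
      from var[OF less[OF this], of i] show ?thesis
        by (simp add: pvar_def mult_single flip: e)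
    qed (simp add: const)
  qed
qed (rule add)

lemma divided_deriv_superset:
  assumes "finite B" "Poly_Mapping.keys f \<subseteq> B"
  shows "divided_deriv \<alpha> f =
    (\<Sum>\<beta>\<in>B. Poly_Mapping.single (\<beta> - \<alpha>) (of_nat (mbinom \<beta> \<alpha>) * Poly_Mapping.lookup f \<beta>))"
  unfolding divided_deriv_def
  by (rule sum.mono_neutral_left) (use assms in \<open>auto simp: in_keys_iff\<close>)

lemma divided_deriv_add: "divided_deriv \<alpha> (f + g) = divided_deriv \<alpha> f + divided_deriv \<alpha> g"
proof -
  let ?B = "Poly_Mapping.keys f \<union> Poly_Mapping.keys g"
  have "divided_deriv \<alpha> (f + g) =
    (\<Sum>\<beta>\<in>?B. Poly_Mapping.single (\<beta> - \<alpha>) (of_nat (mbinom \<beta> \<alpha>) * Poly_Mapping.lookup (f + g) \<beta>))"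
    by (rule divided_deriv_superset) (use Poly_Mapping.keys_add[of f g] in auto)
  also have "\<dots> = divided_deriv \<alpha> f + divided_deriv \<alpha> g"
    by (subst (1 2) divided_deriv_superset[of ?B])
      (auto simp: lookup_add algebra_simps single_add sum.distrib)
  finally show ?thesis .
qed

lemma divided_deriv_single:
  "divided_deriv \<alpha> (Poly_Mapping.single \<beta> c) =
     Poly_Mapping.single (\<beta> - \<alpha>) (of_nat (mbinom \<beta> \<alpha>) * c)"
  by (subst divided_deriv_superset[of "{\<beta>}"]) auto

lemma divided_deriv_pscale: "divided_deriv \<alpha> (pscale c f) = pscale c (divided_deriv \<alpha> f)"
proof (induction f rule: mpoly_add_induct)
  case (1 \<beta> d)
  then show ?case by (simp add: pscale_def mult_single divided_deriv_single mult_ac)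
next
  case (2 f g)
  then show ?case by (simp add: pscale_simps divided_deriv_add)
qed

lemma divided_deriv_linear: "Vector_Spaces.linear pscale pscale (divided_deriv \<alpha>)"
  by (simp add: linear_pscale_iff divided_deriv_add divided_deriv_pscale)

lemma mbinom_split:
  "mbinom \<beta> \<alpha> = (Poly_Mapping.lookup \<beta> i choose Poly_Mapping.lookup \<alpha> i) *
    (\<Prod>j\<in>UNIV - {i}. Poly_Mapping.lookup \<beta> j choose Poly_Mapping.lookup \<alpha> j)"
  unfolding mbinom_def by (subst prod.remove[of UNIV i]) auto

lemma mbinom_eq_0_iff: "mbinom \<beta> \<alpha> = 0 \<longleftrightarrow> (\<exists>j. Poly_Mapping.lookup \<beta> j < Poly_Mapping.lookup \<alpha> j)"
  by (simp add: mbinom_def)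

lemma divided_deriv_pvar:
  "divided_deriv \<alpha> (pvar i * f) = pvar i * divided_deriv \<alpha> f +
     (if Poly_Mapping.lookup \<alpha> i = 0 then 0 else divided_deriv (\<alpha> - evar i) f)"
proof (induction f rule: mpoly_add_induct)
  case (2 f g)
  then show ?case by (simp add: divided_deriv_add algebra_simps split: if_splits)
next
  case (1 \<beta> c)
  let ?l = Poly_Mapping.lookup
  define R where "R = (\<Prod>j\<in>UNIV - {i}. ?l \<beta> j choose ?l \<alpha> j)"
  have b1: "mbinom (evar i + \<beta>) \<alpha> = (Suc (?l \<beta> i) choose ?l \<alpha> i) * R"
    by (subst mbinom_split[of _ _ i]) (auto simp: R_def lookup_add lookup_evar intro!: prod.cong)
  have b2: "mbinom \<beta> \<alpha> = (?l \<beta> i choose ?l \<alpha> i) * R"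
    by (subst mbinom_split[of _ _ i]) (auto simp: R_def)
  have b3: "mbinom \<beta> (\<alpha> - evar i) = (?l \<beta> i choose (?l \<alpha> i - 1)) * R"
    by (subst mbinom_split[of _ _ i]) (auto simp: R_def lookup_minus lookup_evar intro!: prod.cong)
  show ?case
  proof (cases "?l \<alpha> i")
    case 0
    have "evar i + \<beta> - \<alpha> = evar i + (\<beta> - \<alpha>)" 
      using 0 by (intro poly_mapping_eqI) (auto simp: lookup_add lookup_minus lookup_evar)
    then show ?thesis using 0
      by (simp add: pvar_def mult_single divided_deriv_single b1 b2)
  next
    case (Suc k)
    have e1: "evar i + \<beta> - \<alpha> = \<beta> - (\<alpha> - evar i)"
      using Suc by (intro poly_mapping_eqI) (auto simp: lookup_add lookup_minus lookup_evar)
    have e2: "evar i + (\<beta> - \<alpha>) = \<beta> - (\<alpha> - evar i)" if "Suc k \<le> ?l \<beta> i"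
      using Suc that by (intro poly_mapping_eqI) (auto simp: lookup_add lookup_minus lookup_evar)
    have e3: "Poly_Mapping.single (evar i + (\<beta> - \<alpha>)) (of_nat (mbinom \<beta> \<alpha>) * c) =
      Poly_Mapping.single (\<beta> - (\<alpha> - evar i)) (of_nat (mbinom \<beta> \<alpha>) * c)"
      using e2 Suc by (cases "Suc k \<le> ?l \<beta> i") (auto simp: b2 binomial_eq_0)
    show ?thesis using Suc
      by (simp add: pvar_def mult_single divided_deriv_single e3 e1)
        (simp add: b1[unfolded add.commute[of "evar i"]] b2 b3 algebra_simps flip: single_add)
  qed
qed

lemma mult_diff_ops_upto: "(\<lambda>g. r * g) \<in> diff_ops_upto 0"
  by (simp add: linear_pscale_iff mult_commutator_def pscale_simps(3) fun_eq_iff distrib_left mult.left_commute)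

lemma mult_diff_ops_upto': "f \<in> diff_ops_upto i \<Longrightarrow> (\<lambda>g. r * f g) \<in> diff_ops_upto i"
  using diff_ops_upto_comp[OF mult_diff_ops_upto[of r], of f i] by (simp add: comp_def)

lemma mult_diff_ops_upto'': "f \<in> diff_ops_upto i \<Longrightarrow> (\<lambda>g. f (r * g)) \<in> diff_ops_upto i"
  using diff_ops_upto_comp[OF _ mult_diff_ops_upto[of r], of f i] by (simp add: comp_def)

lemma commutator_generators:
  fixes f :: "('n::finite, 'k::field) mpoly \<Rightarrow> _"
  assumes lin: "Vector_Spaces.linear pscale pscale f"
    and var: "\<And>i. mult_commutator f (pvar i) \<in> diff_ops_upto k"
  shows "mult_commutator f r \<in> diff_ops_upto k"
proof (induction r rule: mpoly_induct)
  note lin = lin[unfolded linear_pscale_iff]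
  {
    case (const c)
    have "mult_commutator f (Poly_Mapping.single 0 c) = (\<lambda>_. 0)"
      using lin by (auto simp: mult_commutator_def pscale_def)
    then show ?case using zero_diff_ops_upto by simp
  next
    case (add r s)
    have "mult_commutator f (r + s) = (\<lambda>g. mult_commutator f r g + mult_commutator f s g)"
      using lin by (simp add: mult_commutator_def algebra_simps)
    then show ?case using diff_ops_upto_add[OF add] by simp
  next
    case (var i r)
    have "mult_commutator f (pvar i * r) =
        (\<lambda>g. mult_commutator f (pvar i) (r * g) + pvar i * mult_commutator f r g)"
      using lin by (simp add: mult_commutator_def algebra_simps)
    then show ?case
      using diff_ops_upto_add[OF mult_diff_ops_upto''[OF assms(2)] mult_diff_ops_upto'[OF var]] by simp
  }
qed

lemma divided_deriv_0: "divided_deriv 0 f = f"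
  using mpoly_monomials[of f] by (simp add: divided_deriv_def mbinom_def)

lemma divided_deriv_diff_ops_upto:
  "(divided_deriv \<alpha> :: ('n::finite, 'k::field) mpoly \<Rightarrow> _) \<in> diff_ops_upto (total_degree \<alpha>)"
proof (induction "total_degree \<alpha>" arbitrary: \<alpha>)
  case 0
  then have "\<alpha> = 0" by (intro poly_mapping_eqI) (simp add: total_degree_def)
  then show ?case using mult_diff_ops_upto[of 1] 
    by (simp add: total_degree_def divided_deriv_0[abs_def])
next
  case (Suc k)
  have "mult_commutator (divided_deriv \<alpha> :: ('n, 'k) mpoly \<Rightarrow> _) (pvar i) \<in> diff_ops_upto k" for i
  proof (cases "Poly_Mapping.lookup \<alpha> i = 0")
    case True
    then have "mult_commutator (divided_deriv \<alpha> :: ('n, 'k) mpoly \<Rightarrow> _) (pvar i) = (\<lambda>_. 0)"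
      by (simp add: mult_commutator_def divided_deriv_pvar)
    then show ?thesis using zero_diff_ops_upto by (simp only:)
  next
    case False
    then have e: "mult_commutator (divided_deriv \<alpha> :: ('n, 'k) mpoly \<Rightarrow> _) (pvar i) = divided_deriv (\<alpha> - evar i)"
      by (simp add: mult_commutator_def divided_deriv_pvar)
    have "total_degree (\<alpha> - evar i) = k"
      using Suc.hyps(2) exp_split[of \<alpha> i] False total_degree_add[of "evar i" "\<alpha> - evar i"] by simp
    then show ?thesis using Suc.hyps(1)[of "\<alpha> - evar i"] e by simp
  qed
  from commutator_generators[OF divided_deriv_linear this] show ?case
    by (simp add: divided_deriv_linear flip: Suc.hyps(2))
qed

lemma diff_ops_upto_sum:
  assumes "finite A" "\<And>a. a \<in> A \<Longrightarrow> F a \<in> diff_ops_upto i"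
  shows "(\<lambda>f. \<Sum>a\<in>A. F a f) \<in> diff_ops_upto i"
  using assms by induction (auto simp: zero_diff_ops_upto diff_ops_upto_add)

lemma order_filtration_le: "order_filtration i \<subseteq> diff_ops_upto i"
  unfolding order_filtration_def
  by (auto intro!: diff_ops_upto_sum finite_total_degree_le mult_diff_ops_upto'
      intro: diff_ops_upto_mono[OF _ divided_deriv_diff_ops_upto])

lemma diff_ops_upto_eq_0:
  fixes f :: "('n::finite, 'k::field) mpoly \<Rightarrow> _"
  assumes "f \<in> diff_ops_upto i"
    and "\<And>\<beta>. total_degree \<beta> \<le> i \<Longrightarrow> f (Poly_Mapping.single \<beta> 1) = 0"
  shows "f = (\<lambda>_. 0)"
  using assms
proof (induction i arbitrary: f)
  case 0
  have "f 1 = 0" using 0(2)[of 0] by (simp add: total_degree_def)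
  moreover have "f (r * 1) - r * f 1 = 0" for r
  proof -
    have "mult_commutator f r 1 = 0" using 0(1) by simp
    then show ?thesis by (simp only: mult_commutator_def)
  qed
  ultimately show ?case by (simp add: fun_eq_iff)
next
  case (Suc i)
  note lin = diff_ops_upto_linear[OF Suc.prems(1), unfolded linear_pscale_iff]
  have f1: "f 1 = 0" using Suc.prems(2)[of 0] by (simp add: total_degree_def)
  have c: "mult_commutator f (pvar j) = (\<lambda>_. 0)" for j
  proof (rule Suc.IH)
    show "mult_commutator f (pvar j) \<in> diff_ops_upto i" using Suc.prems(1) by simp
    fix \<beta> :: "'n \<Rightarrow>\<^sub>0 nat" assume "total_degree \<beta> \<le> i"
    then show "mult_commutator f (pvar j) (Poly_Mapping.single \<beta> 1) = 0"
      using Suc.prems(2)[of \<beta>] Suc.prems(2)[of "evar j + \<beta>"]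
      by (simp add: mult_commutator_def pvar_def mult_single total_degree_add)
  qed
  have "f r = 0" for r
  proof (induction r rule: mpoly_induct)
    case (const d)
    then show ?case using lin f1 by (metis mult.right_neutral pscale_def pscale_simps(5))
  next
    case (var j r)
    then show ?case using c[of j] by (auto simp: mult_commutator_def fun_eq_iff)
  qed (use lin in simp)
  then show ?case by auto
qed

lemma mbinom_self [simp]: "mbinom \<alpha> \<alpha> = 1"
  by (simp add: mbinom_def)

lemma mbinom_total_degree:
  assumes "total_degree \<beta> \<le> total_degree \<alpha>" "\<alpha> \<noteq> \<beta>"
  shows "mbinom \<beta> \<alpha> = 0"
proof (rule ccontr)
  assume "mbinom \<beta> \<alpha> \<noteq> 0"
  then have le: "Poly_Mapping.lookup \<alpha> j \<le> Poly_Mapping.lookup \<beta> j" for j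
    by (auto simp: mbinom_eq_0_iff not_less)
  then have "\<beta> = \<alpha> + (\<beta> - \<alpha>)" by (intro poly_mapping_eqI) (simp add: lookup_add lookup_minus)
  with assms(1) have "total_degree (\<beta> - \<alpha>) = 0" using total_degree_add[of \<alpha> "\<beta> - \<alpha>"] by simp
  then have "Poly_Mapping.lookup \<beta> j = Poly_Mapping.lookup \<alpha> j" for j
    using le[of j] by (simp add: total_degree_def lookup_minus le_antisym)
  with assms(2) show False by (metis poly_mapping_eqI)
qed

lemma order_filtration_match:
  fixes v :: "('n::finite \<Rightarrow>\<^sub>0 nat) \<Rightarrow> ('n, 'k::field) mpoly"
  shows "\<exists>g\<in>order_filtration i. \<forall>\<beta>. total_degree \<beta> \<le> i \<longrightarrow> g (Poly_Mapping.single \<beta> 1) = v \<beta>"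
proof (induction i)
  let ?A = "\<lambda>i. {\<alpha> :: 'n \<Rightarrow>\<^sub>0 nat. total_degree \<alpha> \<le> i}"
  {
    case 0
    have Z: "\<beta> = 0" if "total_degree \<beta> = 0" for \<beta> :: "'n \<Rightarrow>\<^sub>0 nat"
      using that by (auto simp: total_degree_def intro!: poly_mapping_eqI)
    have A: "?A 0 = {0}"
      by (auto simp: total_degree_def intro!: poly_mapping_eqI)
    show ?case
      unfolding order_filtration_def
      by (rule bexI[of _ "\<lambda>f. \<Sum>\<alpha>\<in>?A 0. v \<alpha> * divided_deriv \<alpha> f"])
        (use A in \<open>auto simp: divided_deriv_0 dest!: Z\<close>)
  next
    case (Suc i)
    then obtain q where q: "\<And>\<beta>. total_degree \<beta> \<le> i \<Longrightarrow>
        (\<Sum>\<alpha>\<in>?A i. q \<alpha> * divided_deriv \<alpha> (Poly_Mapping.single \<beta> 1)) = v \<beta>"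
      by (auto simp: order_filtration_def)
    let ?g = "\<lambda>\<beta>. \<Sum>\<alpha>\<in>?A i. q \<alpha> * divided_deriv \<alpha> (Poly_Mapping.single \<beta> 1)"
    let ?S = "{\<alpha> :: 'n \<Rightarrow>\<^sub>0 nat. total_degree \<alpha> = Suc i}"
    define q' where "q' \<alpha> = (if total_degree \<alpha> \<le> i then q \<alpha> else v \<alpha> - ?g \<alpha>)" for \<alpha>
    have fin: "finite ?S" by (rule finite_subset[OF _ finite_total_degree_le[of "Suc i"]]) auto
    have A: "?A (Suc i) = ?A i \<union> ?S" by auto
    have eq: "(\<Sum>\<alpha>\<in>?A (Suc i). q' \<alpha> * divided_deriv \<alpha> (Poly_Mapping.single \<beta> 1)) =
        ?g \<beta> + (if total_degree \<beta> = Suc i then v \<beta> - ?g \<beta> else 0)"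
      if "total_degree \<beta> \<le> Suc i" for \<beta>
    proof -
      have "(\<Sum>\<alpha>\<in>?S. q' \<alpha> * divided_deriv \<alpha> (Poly_Mapping.single \<beta> 1)) =
          (\<Sum>\<alpha>\<in>?S. if \<alpha> = \<beta> then q' \<beta> else 0)"
        using that by (intro sum.cong) (auto simp: divided_deriv_single mbinom_total_degree)
      also have "\<dots> = (if total_degree \<beta> = Suc i then v \<beta> - ?g \<beta> else 0)"
        unfolding sum.delta[OF fin] by (simp add: q'_def)
      finally have top: "(\<Sum>\<alpha>\<in>?S. q' \<alpha> * divided_deriv \<alpha> (Poly_Mapping.single \<beta> 1)) = \<dots>" .
      have low: "(\<Sum>\<alpha>\<in>?A i. q' \<alpha> * divided_deriv \<alpha> (Poly_Mapping.single \<beta> 1)) = ?g \<beta>"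
        by (intro sum.cong) (simp_all add: q'_def)
      have disj: "?A i \<inter> ?S = {}" by auto
      show ?thesis
        unfolding A sum.union_disjoint[OF finite_total_degree_le fin disj] low top ..
    qed
    show ?case
      unfolding order_filtration_def
    proof (rule bexI[of _ "\<lambda>f. \<Sum>\<alpha>\<in>?A (Suc i). q' \<alpha> * divided_deriv \<alpha> f"], intro allI impI)
      fix \<beta> :: "'n \<Rightarrow>\<^sub>0 nat" assume b: "total_degree \<beta> \<le> Suc i"
      show "(\<Sum>\<alpha>\<in>?A (Suc i). q' \<alpha> * divided_deriv \<alpha> (Poly_Mapping.single \<beta> 1)) = v \<beta>"
        unfolding eq[OF b] using q[of \<beta>] b by (cases "total_degree \<beta> = Suc i") simp_all
    qed blast
  }
qed

text \<open>
  The two descriptions of the order filtration agree: the span of the \<open>\<partial>\<^sup>[\<^sup>\<alpha>\<^sup>]\<close> with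
  \<open>\<bar>\<alpha>\<bar> \<le> i\<close> is the set of differential operators of order at most \<open>i\<close>.
\<close>

theorem order_filtration_eq:
  "(order_filtration i :: (('n::finite, 'k::field) mpoly \<Rightarrow> _) set) = diff_ops_upto i"
proof
  show "diff_ops_upto i \<subseteq> (order_filtration i :: (('n, 'k) mpoly \<Rightarrow> _) set)"
  proof
    fix f :: "('n, 'k) mpoly \<Rightarrow> ('n, 'k) mpoly"
    assume f: "f \<in> diff_ops_upto i"
    obtain g where g: "g \<in> order_filtration i"
      "\<And>\<beta>. total_degree \<beta> \<le> i \<Longrightarrow> g (Poly_Mapping.single \<beta> 1) = f (Poly_Mapping.single \<beta> 1)"
      using order_filtration_match[of i "\<lambda>\<beta>. f (Poly_Mapping.single \<beta> 1)"] by blast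
    have "g \<in> diff_ops_upto i" using g(1) order_filtration_le by blast
    then have "(\<lambda>x. f x + pscale (- 1) (g x)) \<in> diff_ops_upto i"
      by (intro diff_ops_upto_add f diff_ops_upto_pscale)
    then have "(\<lambda>x. f x + pscale (- 1) (g x)) = (\<lambda>_. 0)"
      by (rule diff_ops_upto_eq_0) (simp add: g(2) pscale_simps)
    then have "f = g" by (simp add: fun_eq_iff pscale_simps)
    with g(1) show "f \<in> order_filtration i" by simp
  qed
qed (rule order_filtration_le)

corollary diff_ops_eq: "diff_ops = (\<Union>i. order_filtration i)"
  by (simp add: order_filtration_eq diff_ops_def)


section \<open>Automorphism groups\<close>

text \<open>
  As in \<open>BijGroup\<close>, automorphisms are extensional on the carrier, so that distinct elements of
  these groups differ on the carrier; the product is composition. The scalars form the whole type \<open>'k\<close>.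
\<close>

definition algebra_auts :: "('k, 'a, 'm) module_scheme \<Rightarrow> ('a \<Rightarrow> 'a) set" where
  "algebra_auts A =
     {\<sigma> \<in> ring_hom A A \<inter> Bij (carrier A).
        \<forall>c. \<forall>a\<in>carrier A. \<sigma> (c \<odot>\<^bsub>A\<^esub> a) = c \<odot>\<^bsub>A\<^esub> \<sigma> a}"

definition algebra_aut_group :: "('k, 'a, 'm) module_scheme \<Rightarrow> ('a \<Rightarrow> 'a) monoid" where
  "algebra_aut_group A = BijGroup (carrier A)\<lparr>carrier := algebra_auts A\<rparr>"

definition order_aut_group ::
  "'n::finite itself \<Rightarrow> 'k::field itself \<Rightarrow>
     ((('n, 'k) mpoly \<Rightarrow> ('n, 'k) mpoly) \<Rightarrow> (('n, 'k) mpoly \<Rightarrow> ('n, 'k) mpoly)) monoid" where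
  "order_aut_group N K =
     algebra_aut_group (diff_op_algebra N K)
       \<lparr>carrier := {\<sigma> \<in> algebra_auts (diff_op_algebra N K).
                      \<forall>i. \<sigma> ` order_filtration i = order_filtration i}\<rparr>"

lemma subgroup_algebra_auts:
  assumes "ring A" and smult: "\<And>c a. a \<in> carrier A \<Longrightarrow> c \<odot>\<^bsub>A\<^esub> a \<in> carrier A"
  shows "subgroup (algebra_auts A) (BijGroup (carrier A))"
proof -
  interpret ring A by fact
  have inv: "restrict (inv_into (carrier A) \<sigma>) (carrier A) \<in> algebra_auts A"
    if s: "\<sigma> \<in> algebra_auts A" for \<sigma>
  proof -
    let ?t = "restrict (inv_into (carrier A) \<sigma>) (carrier A)"
    from s have B: "\<sigma> \<in> Bij (carrier A)" and h: "\<sigma> \<in> ring_hom A A"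
      and k: "\<And>c a. a \<in> carrier A \<Longrightarrow> \<sigma> (c \<odot>\<^bsub>A\<^esub> a) = c \<odot>\<^bsub>A\<^esub> \<sigma> a"
      by (auto simp: algebra_auts_def)
    have bij: "bij_betw \<sigma> (carrier A) (carrier A)" using B by (simp add: Bij_def)
    have tB: "?t \<in> Bij (carrier A)" using B by (rule restrict_inv_into_Bij)
    have tc: "?t x \<in> carrier A" if "x \<in> carrier A" for x
      using that B by (simp add: Bij_inv_into_mem)
    have st: "\<sigma> (?t x) = x" if "x \<in> carrier A" for x
      using that bij by (simp add: bij_betw_inv_into_right)
    have ts: "?t x = y" if "y \<in> carrier A" "\<sigma> y = x" for x y
      using that bij by (auto simp: bij_betw_inv_into_left bij_betwE)
    have "?t \<in> ring_hom A A"
    proof (rule ring_hom_memI)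
      show "?t \<one>\<^bsub>A\<^esub> = \<one>\<^bsub>A\<^esub>"
        by (rule ts) (use h in \<open>simp_all add: ring_hom_one\<close>)
      fix x y assume xy: "x \<in> carrier A" "y \<in> carrier A"
      show "?t (x \<otimes>\<^bsub>A\<^esub> y) = ?t x \<otimes>\<^bsub>A\<^esub> ?t y"
        by (rule ts) (use h xy tc st in \<open>simp_all add: ring_hom_mult del: restrict_apply restrict_apply'\<close>)
      show "?t (x \<oplus>\<^bsub>A\<^esub> y) = ?t x \<oplus>\<^bsub>A\<^esub> ?t y"
        by (rule ts) (use h xy tc st in \<open>simp_all add: ring_hom_add del: restrict_apply restrict_apply'\<close>)
    qed (rule tc)
    moreover have "?t (c \<odot>\<^bsub>A\<^esub> a) = c \<odot>\<^bsub>A\<^esub> ?t a" if "a \<in> carrier A" for c a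
      by (rule ts) (use that tc st k smult in \<open>simp_all del: restrict_apply restrict_apply'\<close>)
    ultimately show ?thesis using tB by (simp add: algebra_auts_def del: restrict_apply restrict_apply')
  qed
  show ?thesis
  proof (rule subgroup.intro)
    show "algebra_auts A \<subseteq> carrier (BijGroup (carrier A))"
      by (auto simp: algebra_auts_def BijGroup_def)
    show "\<one>\<^bsub>BijGroup (carrier A)\<^esub> \<in> algebra_auts A"
      using smult by (auto simp: BijGroup_def algebra_auts_def ring_hom_def id_Bij)
  next
    fix x y assume xy: "x \<in> algebra_auts A" "y \<in> algebra_auts A"
    then have yc: "y a \<in> carrier A" if "a \<in> carrier A" for a
      using that by (auto simp: algebra_auts_def ring_hom_def)
    from xy yc show "x \<otimes>\<^bsub>BijGroup (carrier A)\<^esub> y \<in> algebra_auts A"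
      using smult by (auto simp: BijGroup_def algebra_auts_def compose_Bij ring_hom_def compose_def[of _ x y] Pi_iff)
        (simp add: compose_def[symmetric] compose_Bij)
  next
    fix x assume "x \<in> algebra_auts A"
    then show "inv\<^bsub>BijGroup (carrier A)\<^esub> x \<in> algebra_auts A"
      using inv by (simp add: inv_BijGroup algebra_auts_def)
  qed
qed

lemma group_algebra_aut_group:
  assumes "ring A" "\<And>c a. a \<in> carrier A \<Longrightarrow> c \<odot>\<^bsub>A\<^esub> a \<in> carrier A"
  shows "group (algebra_aut_group A)"
  unfolding algebra_aut_group_def
  by (rule subgroup.subgroup_is_group[OF subgroup_algebra_auts[OF assms] group_BijGroup])

lemma group_poly_auts: "group (algebra_aut_group (poly_algebra TYPE('n::finite) TYPE('k::field)))"
  by (rule group_algebra_aut_group[OF ring_poly_algebra]) (simp add: poly_algebra_def)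

lemma group_order_aut_group: "group (order_aut_group TYPE('n::finite) TYPE('k::field))"
proof -
  let ?D = "diff_op_algebra TYPE('n) TYPE('k)"
  let ?B = "BijGroup (carrier ?D)"
  let ?F = "order_filtration :: nat \<Rightarrow> (('n, 'k) mpoly \<Rightarrow> ('n, 'k) mpoly) set"
  let ?H = "{\<sigma> \<in> algebra_auts ?D. \<forall>i. \<sigma> ` ?F i = ?F i}"
  have F: "x \<in> ?F i \<Longrightarrow> x \<in> carrier ?D" for x i
    by (auto simp: diff_op_algebra_def diff_ops_eq)
  interpret A: subgroup "algebra_auts ?D" ?B
    by (rule subgroup_algebra_auts[OF ring_diff_op_algebra])
      (simp add: diff_op_algebra_def diff_ops_pscale)
  have Bij: "\<sigma> \<in> Bij (carrier ?D)" if "\<sigma> \<in> algebra_auts ?D" for \<sigma>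
    using that by (simp add: algebra_auts_def)
  have "subgroup ?H ?B"
  proof (rule subgroup.intro)
    show "?H \<subseteq> carrier ?B" using A.subset by auto
    have "\<one>\<^bsub>?B\<^esub> ` ?F i = ?F i" for i
      using F by (auto simp: BijGroup_def image_iff)
    then show "\<one>\<^bsub>?B\<^esub> \<in> ?H" using A.one_closed by auto
  next
    fix \<sigma> \<tau> assume st: "\<sigma> \<in> ?H" "\<tau> \<in> ?H"
    then have "(\<sigma> \<otimes>\<^bsub>?B\<^esub> \<tau>) ` ?F i = (\<lambda>x. \<sigma> (\<tau> x)) ` ?F i" for i
      using F[of _ i] Bij[of \<sigma>] Bij[of \<tau>]
      by (simp add: BijGroup_def compose_def image_image cong: image_cong_simp)
    moreover have "(\<lambda>x. \<sigma> (\<tau> x)) ` ?F i = \<sigma> ` (\<tau> ` ?F i)" for i by (simp only: image_image)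
    ultimately have "(\<sigma> \<otimes>\<^bsub>?B\<^esub> \<tau>) ` ?F i = ?F i" for i using st by simp
    with st show "\<sigma> \<otimes>\<^bsub>?B\<^esub> \<tau> \<in> ?H" using A.m_closed by auto
  next
    fix \<sigma> assume s: "\<sigma> \<in> ?H"
    then have bij: "bij_betw \<sigma> (carrier ?D) (carrier ?D)" using Bij by (simp add: Bij_def)
    have "(inv\<^bsub>?B\<^esub> \<sigma>) ` ?F i = ?F i" for i
    proof -
      have "(inv\<^bsub>?B\<^esub> \<sigma>) ` ?F i = inv_into (carrier ?D) \<sigma> ` ?F i"
        using s Bij[of \<sigma>] F by (auto simp: inv_BijGroup)
      also have "\<dots> = inv_into (carrier ?D) \<sigma> ` \<sigma> ` ?F i" using s by simp
      also have "\<dots> = ?F i"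
        using bij F by (intro inv_into_image_cancel) (auto simp: bij_betw_def)
      finally show ?thesis .
    qed
    with s show "inv\<^bsub>?B\<^esub> \<sigma> \<in> ?H" using A.m_inv_closed by auto
  qed
  from subgroup.subgroup_is_group[OF this group_BijGroup] show ?thesis
    by (simp add: order_aut_group_def algebra_aut_group_def)
qed

end

theory Submission
  imports Defs
begin

text \<open>
  The isomorphism restricts an order preserving automorphism \<open>\<sigma>\<close> to the polynomials. The operators of
  order \<open>0\<close> are exactly the multiplications by polynomials, so \<open>\<sigma>\<close> permutes them and induces an
  automorphism of \<open>P\<^sub>n\<close> (\<open>poly_restriction_aut\<close>). Restriction is onto because every \<open>\<tau>\<close> in
  \<open>Aut\<^sub>K(P\<^sub>n)\<close> is the restriction of the conjugation \<open>f \<mapsto> \<tau> f \<tau>\<^sup>-\<^sup>1\<close>, which respects commutators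
  with polynomials and hence the order (\<open>conjugation_order_aut\<close>).

  The substance is injectivity: an endomorphism \<open>\<sigma>\<close> of the ring \<open>\<D>(P\<^sub>n)\<close> that fixes every polynomial
  is the identity (\<open>rigidity\<close>). This fails in characteristic \<open>0\<close>, where \<open>\<partial> \<mapsto> \<partial> + a\<close>
  extends to an automorphism of \<open>\<D>(K[x])\<close> for every polynomial \<open>a\<close>. The proof is by induction on the order. If
  \<open>\<sigma>\<close> fixes all operators of smaller order, then \<open>\<sigma>(\<partial>\<^sup>[\<^sup>\<alpha>\<^sup>]) - \<partial>\<^sup>[\<^sup>\<alpha>\<^sup>]\<close> commutes with all polynomials and is
  therefore multiplication by a polynomial \<open>a\<close>. In characteristic \<open>p\<close> two facts force \<open>a = 0\<close> when \<open>\<alpha> \<noteq> 0\<close>: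

  \<^item> \<open>(\<partial>\<^sup>[\<^sup>\<alpha>\<^sup>])\<^sup>p = 0\<close>, because \<open>(\<partial>\<^sup>[\<^sup>\<alpha>\<^sup>])\<^sup>p\<close> is a multiple of \<open>\<partial>\<^sup>[\<^sup>p\<^sup>\<alpha>\<^sup>]\<close> by a product of binomial
    coefficients, one of which is divisible by \<open>p\<close> (\<open>divided_deriv_nilpotent\<close>). Applying \<open>\<sigma>\<close> gives
    \<open>(\<partial>\<^sup>[\<^sup>\<alpha>\<^sup>] + a)\<^sup>p = 0\<close>.
  \<^item> \<open>\<partial>\<^sup>[\<^sup>\<alpha>\<^sup>]\<close> lowers degrees, so that \<open>(\<partial>\<^sup>[\<^sup>\<alpha>\<^sup>] + a)\<^sup>p\<close> sends \<open>1\<close> to \<open>a\<^sup>p\<close> plus terms of degree less than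
    \<open>p deg a\<close>. By the Frobenius identity \<open>a\<^sup>p\<close> has a nonzero coefficient in degree \<open>p deg a\<close>
    if \<open>a \<noteq> 0\<close> (\<open>nilpotent_perturbation\<close>).

  The operators \<open>\<partial>\<^sup>[\<^sup>\<alpha>\<^sup>]\<close> with \<open>\<bar>\<alpha>\<bar> \<le> i\<close> generate the operators of order at most \<open>i\<close> over \<open>P\<^sub>n\<close>, which
  completes the induction step.
\<close>


section \<open>Nilpotency of the divided powers\<close>

text \<open>
  If \<open>b < a + g\<close>, both sides vanish, also when the subtraction is truncated.
\<close>

lemma binomial_trinomial_revision:
  "(b - g choose a) * (b choose g) = (a + g choose g) * (b choose (a + g))"
proof (cases "a + g \<le> b")
  case True
  then show ?thesis using choose_mult[of g "a + g" b] by (simp add: mult.commute)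
next
  case False
  then show ?thesis by (cases "g \<le> b") (auto simp: binomial_eq_0)
qed

lemma mbinom_trinomial_revision:
  "mbinom (\<beta> - \<gamma>) \<alpha> * mbinom \<beta> \<gamma> = mbinom (\<alpha> + \<gamma>) \<gamma> * mbinom \<beta> (\<alpha> + \<gamma>)"
  by (simp add: mbinom_def lookup_add lookup_minus binomial_trinomial_revision flip: prod.distrib)

lemma of_nat_mult_single:
  "of_nat m * Poly_Mapping.single \<beta> (c::'k::field) = Poly_Mapping.single \<beta> (of_nat m * c)"
  by (simp add: mult_single flip: single_of_nat)

lemma divided_deriv_comp:
  fixes f :: "('n::finite, 'k::field) mpoly"
  shows "divided_deriv \<alpha> (divided_deriv \<gamma> f) =
    of_nat (mbinom (\<alpha> + \<gamma>) \<gamma>) * divided_deriv (\<alpha> + \<gamma>) f"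
proof (induction f rule: mpoly_add_induct)
  case (1 \<beta> c)
  have e: "\<beta> - \<gamma> - \<alpha> = \<beta> - (\<alpha> + \<gamma>)"
    by (rule poly_mapping_eqI) (simp add: lookup_add lookup_minus)
  show ?case
    using mbinom_trinomial_revision[of \<beta> \<gamma> \<alpha>, THEN arg_cong[of _ _ "of_nat :: nat \<Rightarrow> 'k"]]
    by (simp add: divided_deriv_single of_nat_mult_single e flip: mult.assoc)
qed (simp add: divided_deriv_add distrib_left)

lemma divided_deriv_of_nat_mult:
  "divided_deriv \<alpha> (of_nat m * f) = of_nat m * divided_deriv \<alpha> f"
  using divided_deriv_pscale[of \<alpha> "of_nat m" f] by (simp add: pscale_def)

text \<open>
  The exponent vector \<open>k\<alpha>\<close>. It is defined by iterated addition because the product \<open>of_nat k * \<alpha>\<close> of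
  finitely supported functions is a convolution, which needs an addition on the index type.
\<close>

definition exp_times :: "nat \<Rightarrow> ('n \<Rightarrow>\<^sub>0 nat) \<Rightarrow> ('n \<Rightarrow>\<^sub>0 nat)" where
  "exp_times k \<alpha> = ((+) \<alpha> ^^ k) 0"

lemma exp_times_0 [simp]: "exp_times 0 \<alpha> = 0"
  by (simp add: exp_times_def)

lemma exp_times_Suc [simp]: "exp_times (Suc k) \<alpha> = \<alpha> + exp_times k \<alpha>"
  by (simp add: exp_times_def)

lemma lookup_exp_times: "Poly_Mapping.lookup (exp_times k \<alpha>) i = k * Poly_Mapping.lookup \<alpha> i"
  by (induction k) (simp_all add: lookup_add)

lemma divided_deriv_funpow:
  obtains m where
    "\<And>f :: ('n::finite, 'k::field) mpoly. (divided_deriv \<alpha> ^^ k) f = of_nat m * divided_deriv (exp_times k \<alpha>) f"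
proof (induction k arbitrary: thesis)
  case 0
  show ?case by (rule 0[of 1]) (simp add: divided_deriv_0)
next
  case (Suc k)
  obtain m where "\<And>f :: ('n, 'k) mpoly. (divided_deriv \<alpha> ^^ k) f = of_nat m * divided_deriv (exp_times k \<alpha>) f"
    using Suc.IH by blast
  then show ?case
    by (intro Suc.prems[of "m * mbinom (\<alpha> + exp_times k \<alpha>) (exp_times k \<alpha>)"])
      (simp add: divided_deriv_of_nat_mult divided_deriv_comp mult.assoc)
qed

text \<open>
  The absorption identity \<open>a (pa choose a) = pa (pa - 1 choose a - 1)\<close> exhibits the factor \<open>p\<close>.
\<close>

lemma dvd_binomial_mult:
  assumes "0 < p" "0 < a" shows "p dvd (p * a choose a)"
proof -
  have "a * (p * a choose a) = a * (p * (p * a - 1 choose (a - 1)))"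
    using times_binomial_minus1_eq[of a "p * a"] assms(2) by (simp add: mult_ac)
  with assms(2) show ?thesis by (metis dvd_triv_left mult_left_cancel neq0_conv)
qed

text \<open>
  With \<open>\<gamma> = (p - 1)\<alpha>\<close>, the last of the \<open>p\<close> factors contributes \<open>\<partial>\<^sup>[\<^sup>\<alpha>\<^sup>] \<partial>\<^sup>[\<^sup>\<gamma>\<^sup>]\<close>, which is \<open>\<partial>\<^sup>[\<^sup>p\<^sup>\<alpha>\<^sup>]\<close>
  times a product over \<open>i\<close> of the binomial coefficients \<open>p\<alpha>\<^sub>i choose \<alpha>\<^sub>i\<close>. Any \<open>i\<close> with \<open>\<alpha>\<^sub>i \<noteq> 0\<close> makes
  this product divisible by \<open>p\<close>.
\<close>

lemma divided_deriv_nilpotent: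
  fixes f :: "('n::finite, 'k::field) mpoly"
  assumes p: "CHAR('k) = p" "p > 0" and "\<alpha> \<noteq> 0"
  shows "(divided_deriv \<alpha> ^^ p) f = 0"
proof -
  let ?l = Poly_Mapping.lookup
  from \<open>\<alpha> \<noteq> 0\<close> obtain i where i: "?l \<alpha> i > 0" by (metis exp_cases)
  obtain q where q: "p = Suc q" using p(2) gr0_implies_Suc by blast
  let ?\<gamma> = "exp_times q \<alpha>"
  obtain m where m: "\<And>f :: ('n, 'k) mpoly. (divided_deriv \<alpha> ^^ q) f = of_nat m * divided_deriv ?\<gamma> f"
    using divided_deriv_funpow[of q \<alpha>] by blast
  have "p dvd (?l (\<alpha> + ?\<gamma>) i choose ?l ?\<gamma> i)"
    using dvd_binomial_mult[OF p(2) i] binomial_symmetric[of "?l ?\<gamma> i" "?l (\<alpha> + ?\<gamma>) i"]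
    by (simp add: lookup_add lookup_exp_times q)
  then have "p dvd mbinom (\<alpha> + ?\<gamma>) ?\<gamma>" by (subst mbinom_split[of _ _ i]) simp
  then have "of_nat (mbinom (\<alpha> + ?\<gamma>) ?\<gamma>) = (0 :: 'k)" by (simp add: of_nat_eq_0_iff_char_dvd p(1))
  then have "of_nat (mbinom (\<alpha> + ?\<gamma>) ?\<gamma>) = (0 :: ('n, 'k) mpoly)" by (metis single_of_nat single_zero)
  then show ?thesis by (simp add: q m divided_deriv_of_nat_mult divided_deriv_comp)
qed


section \<open>Perturbing a degree-lowering operator\<close>

text \<open>
  A strict bound makes \<open>degree_less 0 f\<close> mean \<open>f = 0\<close>, so that an operator lowering degrees must
  kill the constants.
\<close>

definition degree_less :: "nat \<Rightarrow> ('n::finite, 'k::field) mpoly \<Rightarrow> bool" where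
  "degree_less N f \<longleftrightarrow> (\<forall>\<beta>\<in>Poly_Mapping.keys f. total_degree \<beta> < N)"

lemma degree_less_0 [simp]: "degree_less N 0"
  by (simp add: degree_less_def)

lemma degree_less_mono: "degree_less M f \<Longrightarrow> M \<le> N \<Longrightarrow> degree_less N f"
  by (auto simp: degree_less_def)

lemma degree_less_add: "degree_less N f \<Longrightarrow> degree_less N g \<Longrightarrow> degree_less N (f + g)"
  using keys_add[of f g] by (auto simp: degree_less_def)

lemma degree_less_mult: "degree_less (Suc M) f \<Longrightarrow> degree_less N g \<Longrightarrow> degree_less (M + N) (f * g)"
  using keys_mult[of f g] by (fastforce simp: degree_less_def total_degree_add less_Suc_eq_le)

lemma degree_less_divided_deriv:
  assumes "degree_less (Suc N) f" "\<alpha> \<noteq> 0"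
  shows "degree_less N (divided_deriv \<alpha> f)"
proof -
  have "total_degree (\<beta> - \<alpha>) < N" if b: "mbinom \<beta> \<alpha> \<noteq> 0" "\<beta> \<in> Poly_Mapping.keys f" for \<beta>
  proof -
    have "\<beta> = \<alpha> + (\<beta> - \<alpha>)" using b(1)
      by (intro poly_mapping_eqI) (auto simp: lookup_add lookup_minus mbinom_eq_0_iff not_less)
    then have "total_degree \<beta> = total_degree \<alpha> + total_degree (\<beta> - \<alpha>)"
      by (metis total_degree_add)
    moreover have "total_degree \<alpha> > 0"
      using assms(2) by (metis exp_cases exp_split total_degree_add total_degree_evar add_gr_0 zero_less_one)
    ultimately show ?thesis using b(2) assms(1) by (auto simp: degree_less_def)
  qed
  moreover have "\<exists>\<beta>\<in>Poly_Mapping.keys f. mbinom \<beta> \<alpha> \<noteq> 0 \<and> \<delta> = \<beta> - \<alpha>"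
    if d: "\<delta> \<in> Poly_Mapping.keys (divided_deriv \<alpha> f)" for \<delta>
  proof -
    from d obtain \<beta> where "\<beta> \<in> Poly_Mapping.keys f"
      "\<delta> \<in> Poly_Mapping.keys (Poly_Mapping.single (\<beta> - \<alpha>) (of_nat (mbinom \<beta> \<alpha>) * Poly_Mapping.lookup f \<beta>))"
      unfolding divided_deriv_def using keys_sum by fastforce
    then show ?thesis by (intro bexI[of _ \<beta>]) (auto split: if_splits intro!: Nat.gr0I)
  qed
  ultimately show ?thesis unfolding degree_less_def by blast
qed

lemma degree_less_power: "degree_less (Suc d) a \<Longrightarrow> degree_less (Suc (k * d)) (a ^ k)"
proof (induction k)
  case 0
  show ?case by (auto simp: degree_less_def total_degree_def)
next
  case (Suc k)
  from degree_less_mult[OF Suc.prems Suc.IH[OF Suc.prems]] show ?case by simp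
qed

text \<open>
  Only the term \<open>a\<^sup>k\<close> that multiplies by \<open>a\<close> in every step can reach degree \<open>k d\<close>: each use of \<open>D\<close>
  lowers the degree and gives up a factor \<open>a\<close>.
\<close>

lemma funpow_perturbation_leading:
  assumes a: "degree_less (Suc d) a"
    and add: "\<And>x y. D (x + y) = D x + D y"
    and low: "\<And>N x. degree_less (Suc N) x \<Longrightarrow> degree_less N (D x)"
  shows "\<exists>h. degree_less (k * d) h \<and> ((\<lambda>g. D g + a * g) ^^ k) 1 = a ^ k + h"
proof (induction k)
  case (Suc k)
  then obtain h where h: "degree_less (k * d) h" "((\<lambda>g. D g + a * g) ^^ k) 1 = a ^ k + h" by blast
  have D: "degree_less (k * d) (D (a ^ k))" "degree_less (k * d) (D h)"
    using low degree_less_power[OF a] degree_less_mono[OF h(1)] by simp_all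
  have "degree_less (Suc k * d) (D (a ^ k) + D h + a * h)"
    using D[THEN degree_less_mono] degree_less_mult[OF a h(1)] by (intro degree_less_add) simp_all
  then show ?case
    by (intro exI[of _ "D (a ^ k) + D h + a * h"]) (simp add: h(2) add distrib_left)
qed (simp add: exI[of _ 0])

lemma single_power: "Poly_Mapping.single \<beta> c ^ k = Poly_Mapping.single (exp_times k \<beta>) (c ^ k)"
  by (induction k) (simp_all add: mult_single)

lemma CHAR_mpoly: "CHAR(('n::finite, 'k::field) mpoly) = CHAR('k)"
proof (rule CHAR_eqI)
  have of_nat_0: "of_nat m = (0 :: ('n, 'k) mpoly) \<longleftrightarrow> of_nat m = (0 :: 'k)" for m
  proof -
    have "Poly_Mapping.single 0 c = (0 :: ('n, 'k) mpoly) \<longleftrightarrow> c = 0" for c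
      by (metis lookup_single_eq lookup_zero single_zero)
    from this[of "of_nat m"] show ?thesis by simp
  qed
  show "of_nat CHAR('k) = (0 :: ('n, 'k) mpoly)" by (simp add: of_nat_0)
  show "CHAR('k) dvd m" if "of_nat m = (0 :: ('n, 'k) mpoly)" for m
    using that by (simp add: of_nat_0 of_nat_eq_0_iff_char_dvd)
qed

text \<open>
  Taking \<open>p\<close>-th powers is additive, so it suffices to look at single monomials. This replaces the
  statement that the polynomial ring has no zero divisors: it shows directly that the leading part
  of \<open>a\<close> does not disappear in \<open>a\<^sup>p\<close>.
\<close>

lemma lookup_frobenius:
  fixes a :: "('n::finite, 'k::field) mpoly"
  assumes p: "CHAR('k) = p" "p > 0"
  shows "Poly_Mapping.lookup (a ^ p) (exp_times p \<beta>) = Poly_Mapping.lookup a \<beta> ^ p"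
proof -
  have pr: "Factorial_Ring.prime p" using prime_CHAR_semidom[where 'a = 'k] p by simp
  show ?thesis
  proof (induction a rule: mpoly_add_induct)
    case (1 \<delta> c)
    have "exp_times p \<delta> = exp_times p \<beta> \<longleftrightarrow> \<delta> = \<beta>"
      using p(2) by (auto simp: poly_mapping_eq_iff fun_eq_iff lookup_exp_times)
    then show ?case using p(2) by (simp add: single_power lookup_single when_def)
  next
    case (2 f g)
    have "(f + g) ^ p = f ^ p + g ^ p"
      by (rule freshmans_dream) (simp_all add: CHAR_mpoly pr p(1))
    moreover have "(x + y) ^ p = x ^ p + y ^ p" for x y :: 'k
      by (rule freshmans_dream) (simp_all add: pr p(1))
    ultimately show ?case using 2 by (simp add: lookup_add)
  qed
qed

text \<open>
  For a monomial \<open>x\<^sup>\<beta>\<close> of maximal degree in \<open>a \<noteq> 0\<close>, the coefficient of \<open>x\<^sup>p\<^sup>\<beta>\<close> in \<open>(D + a)\<^sup>p(1)\<close> is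
  that of \<open>a\<^sup>p\<close>, since the remaining terms have smaller degree; it is the \<open>p\<close>-th power of a nonzero
  scalar.
\<close>

lemma nilpotent_perturbation:
  fixes a :: "('n::finite, 'k::field) mpoly"
  assumes p: "CHAR('k) = p" "p > 0"
    and add: "\<And>x y. D (x + y) = D x + D y"
    and low: "\<And>N x. degree_less (Suc N) x \<Longrightarrow> degree_less N (D x)"
    and nil: "((\<lambda>g. D g + a * g) ^^ p) 1 = 0"
  shows "a = 0"
proof (rule ccontr)
  assume "a \<noteq> 0"
  define d where "d = Max (total_degree ` Poly_Mapping.keys a)"
  have ne: "Poly_Mapping.keys a \<noteq> {}" using \<open>a \<noteq> 0\<close> by simp
  then have "d \<in> total_degree ` Poly_Mapping.keys a" unfolding d_def by (intro Max_in) auto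
  then obtain \<beta> where b: "\<beta> \<in> Poly_Mapping.keys a" "total_degree \<beta> = d" by blast
  have "degree_less (Suc d) a"
    by (auto simp: degree_less_def less_Suc_eq_le d_def)
  from funpow_perturbation_leading[where D = D and k = p, OF this add low] nil
  obtain h where h: "degree_less (p * d) h" "a ^ p + h = 0" by auto
  have "total_degree (exp_times p \<beta>) = p * d"
    by (simp add: total_degree_def lookup_exp_times sum_distrib_left flip: b(2))
  then have "Poly_Mapping.lookup h (exp_times p \<beta>) = 0"
    using h(1) by (metis degree_less_def in_keys_iff less_irrefl)
  then have "Poly_Mapping.lookup (a ^ p) (exp_times p \<beta>) = 0"
    using arg_cong[OF h(2), of "\<lambda>f. Poly_Mapping.lookup f (exp_times p \<beta>)"] by (simp add: lookup_add)
  then have "Poly_Mapping.lookup a \<beta> = 0" using p by (simp add: lookup_frobenius)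
  with b(1) show False by (simp add: in_keys_iff)
qed


section \<open>Rigidity: endomorphisms of the ring of differential operators fixing the polynomials\<close>

lemma mult_diff_ops: "(*) r \<in> diff_ops"
  using mult_diff_ops_upto[of r] by (auto simp: diff_ops_def intro!: exI[of _ 0])

text \<open>
  An operator that commutes with all multiplications is multiplication by its value at \<open>1\<close>.
\<close>

lemma diff_ops_upto_0: "(diff_ops_upto 0 :: (('n::finite, 'k::field) mpoly \<Rightarrow> ('n, 'k) mpoly) set) = range (*)"
proof
  show "(diff_ops_upto 0 :: (('n, 'k) mpoly \<Rightarrow> ('n, 'k) mpoly) set) \<subseteq> range (*)"
  proof
    fix f :: "('n, 'k) mpoly \<Rightarrow> ('n, 'k) mpoly" assume "f \<in> diff_ops_upto 0"
    then have comm: "mult_commutator f r 1 = 0" for r by simp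
    have "f r = f 1 * r" for r using comm[of r] by (simp add: mult_commutator_def mult.commute)
    then have "f = (*) (f 1)" by (rule ext)
    then show "f \<in> range (*)" by blast
  qed
  show "range (*) \<subseteq> (diff_ops_upto 0 :: (('n, 'k) mpoly \<Rightarrow> ('n, 'k) mpoly) set)" using mult_diff_ops_upto by blast
qed

locale diff_op_hom =
  fixes \<sigma> :: "(('n::finite, 'k::field) mpoly \<Rightarrow> ('n, 'k) mpoly) \<Rightarrow> (('n, 'k) mpoly \<Rightarrow> ('n, 'k) mpoly)"
  assumes hom: "\<sigma> \<in> ring_hom (diff_op_algebra TYPE('n) TYPE('k)) (diff_op_algebra TYPE('n) TYPE('k))"
begin

lemma hom_comp: "f \<in> diff_ops \<Longrightarrow> g \<in> diff_ops \<Longrightarrow> \<sigma> (f \<circ> g) = \<sigma> f \<circ> \<sigma> g"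
  using ring_hom_mult[OF hom, of f g] by (simp add: diff_op_algebra_def)

lemma hom_add: "f \<in> diff_ops \<Longrightarrow> g \<in> diff_ops \<Longrightarrow> \<sigma> (\<lambda>x. f x + g x) = (\<lambda>x. \<sigma> f x + \<sigma> g x)"
  using ring_hom_add[OF hom, of f g] by (simp add: diff_op_algebra_def)

lemma hom_id: "\<sigma> id = id"
  using ring_hom_one[OF hom] by (simp add: diff_op_algebra_def)

lemma hom_zero: "\<sigma> (\<lambda>_. 0) = (\<lambda>_. 0)"
  using hom_add[OF zero_diff_ops zero_diff_ops] by (simp add: fun_eq_iff)

lemma funpow_closed: "f \<in> diff_ops \<Longrightarrow> f ^^ k \<in> diff_ops"
  by (induction k) (auto simp: id_diff_ops diff_ops_comp)

lemma hom_funpow: "f \<in> diff_ops \<Longrightarrow> \<sigma> (f ^^ k) = \<sigma> f ^^ k"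
  by (induction k) (simp_all add: hom_id hom_comp funpow_closed)

lemma hom_sum:
  "finite A \<Longrightarrow> (\<And>a. a \<in> A \<Longrightarrow> F a \<in> diff_ops) \<Longrightarrow>
    (\<lambda>x. \<Sum>a\<in>A. F a x) \<in> diff_ops \<and> \<sigma> (\<lambda>x. \<Sum>a\<in>A. F a x) = (\<lambda>x. \<Sum>a\<in>A. \<sigma> (F a) x)"
  by (induction A rule: finite_induct) (auto simp: zero_diff_ops hom_zero hom_add diff_ops_add)

end

locale diff_op_hom_fixing_mult = diff_op_hom \<sigma>
  for \<sigma> :: "(('n::finite, 'k::field) mpoly \<Rightarrow> ('n, 'k) mpoly) \<Rightarrow> (('n, 'k) mpoly \<Rightarrow> ('n, 'k) mpoly)" +
  assumes fix_mult: "\<sigma> ((*) r) = (*) r"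
begin

text \<open>
  The commutator with \<open>r\<close> is the ring expression \<open>f r + (- r) f\<close>, whose multiplications \<open>\<sigma>\<close> leaves
  unchanged.
\<close>

lemma hom_mult_commutator:
  assumes "f \<in> diff_ops"
  shows "\<sigma> (mult_commutator f r) = mult_commutator (\<sigma> f) r"
proof -
  have "mult_commutator g r = (\<lambda>x. (g \<circ> (*) r) x + ((*) (- r) \<circ> g) x)" for g :: "('n, 'k) mpoly \<Rightarrow> _"
    by (simp add: mult_commutator_def fun_eq_iff)
  then show ?thesis
    using assms by (simp only: hom_add hom_comp fix_mult diff_ops_comp mult_diff_ops)
qed

text \<open>
  By the preceding lemma \<open>f\<close> and \<open>\<sigma> f\<close> have the same commutators with polynomials, so their difference is
  multiplication by its value at \<open>1\<close>.
\<close>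

lemma differs_by_mult:
  assumes "f \<in> diff_ops" "\<And>r. \<sigma> (mult_commutator f r) = mult_commutator f r"
  shows "\<sigma> f = (\<lambda>g. f g + (\<sigma> f 1 - f 1) * g)"
proof
  fix g
  have "mult_commutator (\<sigma> f) g 1 = mult_commutator f g 1"
    using assms hom_mult_commutator by simp
  then show "\<sigma> f g = f g + (\<sigma> f 1 - f 1) * g"
    by (simp add: mult_commutator_def algebra_simps)
qed

text \<open>
  The step of the induction on the order, where the hypothesis applies to the commutators of
  \<open>\<partial>\<^sup>[\<^sup>\<alpha>\<^sup>]\<close>. For \<open>\<alpha> \<noteq> 0\<close> the image of \<open>\<partial>\<^sup>[\<^sup>\<alpha>\<^sup>]\<close> is again nilpotent, and a nonzero multiplication added to
  \<open>\<partial>\<^sup>[\<^sup>\<alpha>\<^sup>]\<close> would destroy this.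
\<close>

lemma fixes_divided_deriv:
  assumes p: "CHAR('k) = p" "p > 0"
    and comm: "\<And>r. \<sigma> (mult_commutator (divided_deriv \<alpha>) r) = mult_commutator (divided_deriv \<alpha>) r"
  shows "\<sigma> (divided_deriv \<alpha>) = divided_deriv \<alpha>"
proof (cases "\<alpha> = 0")
  case True
  then have "divided_deriv \<alpha> = ((*) 1 :: ('n, 'k) mpoly \<Rightarrow> _)" by (simp add: divided_deriv_0 fun_eq_iff)
  then show ?thesis by (simp only: fix_mult)
next
  case False
  let ?D = "divided_deriv \<alpha> :: ('n, 'k) mpoly \<Rightarrow> _"
  let ?a = "\<sigma> ?D 1 - ?D 1"
  have D: "?D \<in> diff_ops" using divided_deriv_diff_ops_upto by (auto simp: diff_ops_def)
  note e = differs_by_mult[OF D comm]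
  have "?D ^^ p = (\<lambda>_. 0)" using divided_deriv_nilpotent[OF p False] by blast
  then have "\<sigma> ?D ^^ p = (\<lambda>_. 0)" using hom_funpow[OF D, of p] by (simp add: hom_zero)
  then have "((\<lambda>g. ?D g + ?a * g) ^^ p) 1 = 0" by (simp flip: e)
  then have "?a = 0"
    using nilpotent_perturbation[where D = ?D and a = ?a, OF p divided_deriv_add degree_less_divided_deriv[OF _ False]]
    by blast
  with e show ?thesis by simp
qed

text \<open>
  Once the divided powers up to order \<open>i + 1\<close> are fixed, so are their combinations with polynomial
  coefficients, and these are all operators of order at most \<open>i + 1\<close>.
\<close>

theorem rigidity:
  assumes p: "CHAR('k) > 0" and "f \<in> diff_ops"
  shows "\<sigma> f = f"
proof -
  have "f \<in> diff_ops_upto i \<Longrightarrow> \<sigma> f = f" for i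
  proof (induction i arbitrary: f)
    case 0
    then show ?case using fix_mult by (auto simp: diff_ops_upto_0 simp del: diff_ops_upto.simps)
  next
    case (Suc i)
    have D: "(divided_deriv \<alpha> :: ('n, 'k) mpoly \<Rightarrow> _) \<in> diff_ops" for \<alpha>
      using divided_deriv_diff_ops_upto by (auto simp: diff_ops_def)
    have fixD: "\<sigma> (divided_deriv \<alpha>) = divided_deriv \<alpha>" if "total_degree \<alpha> \<le> Suc i" for \<alpha>
    proof (rule fixes_divided_deriv[OF refl p], rule Suc.IH)
      fix r :: "('n, 'k) mpoly"
      show "mult_commutator (divided_deriv \<alpha>) r \<in> diff_ops_upto i"
        using that diff_ops_upto_mono[of "total_degree \<alpha>" "Suc i" "divided_deriv \<alpha> :: ('n, 'k) mpoly \<Rightarrow> _"]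
          divided_deriv_diff_ops_upto by auto
    qed
    from Suc.prems obtain q where q: "f = (\<lambda>g. \<Sum>\<alpha> | total_degree \<alpha> \<le> Suc i. ((*) (q \<alpha>) \<circ> divided_deriv \<alpha>) g)"
      by (auto simp: order_filtration_def simp flip: order_filtration_eq)
    have "\<sigma> ((*) (q \<alpha>) \<circ> divided_deriv \<alpha>) = (*) (q \<alpha>) \<circ> divided_deriv \<alpha>" if "total_degree \<alpha> \<le> Suc i" for \<alpha>
      using that by (simp only: hom_comp D mult_diff_ops fix_mult fixD)
    then show ?case
      unfolding q
      by (subst hom_sum[THEN conjunct2]) (auto simp: finite_total_degree_le D mult_diff_ops diff_ops_comp simp del: comp_apply)
  qed
  then show ?thesis using assms(2) by (auto simp: diff_ops_def)
qed

end


section \<open>Restriction and conjugation\<close>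

lemma poly_aut_iff:
  "\<tau> \<in> algebra_auts (poly_algebra TYPE('n::finite) TYPE('k::field)) \<longleftrightarrow>
     bij \<tau> \<and> \<tau> 1 = 1 \<and> (\<forall>r s. \<tau> (r + s) = \<tau> r + \<tau> s) \<and> (\<forall>r s. \<tau> (r * s) = \<tau> r * \<tau> s) \<and>
     (\<forall>c r. \<tau> (pscale c r) = pscale c (\<tau> r))"
  by (auto simp: algebra_auts_def poly_algebra_def ring_hom_def Bij_def extensional_def)

lemma order_aut_iff:
  "\<sigma> \<in> carrier (order_aut_group TYPE('n::finite) TYPE('k::field)) \<longleftrightarrow>
     \<sigma> \<in> ring_hom (diff_op_algebra TYPE('n) TYPE('k)) (diff_op_algebra TYPE('n) TYPE('k)) \<and>
     \<sigma> \<in> Bij diff_ops \<and>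
     (\<forall>c. \<forall>f\<in>diff_ops. \<sigma> (\<lambda>x. pscale c (f x)) = (\<lambda>x. pscale c (\<sigma> f x))) \<and>
     (\<forall>i. \<sigma> ` diff_ops_upto i = diff_ops_upto i)"
proof -
  let ?D = "diff_op_algebra TYPE('n) TYPE('k)"
  have D: "carrier ?D = diff_ops" "c \<odot>\<^bsub>?D\<^esub> f = (\<lambda>x. pscale c (f x))" for c f
    by (simp_all add: diff_op_algebra_def)
  have "carrier (order_aut_group TYPE('n) TYPE('k)) =
      {\<sigma> \<in> algebra_auts ?D. \<forall>i. \<sigma> ` order_filtration i = order_filtration i}"
    by (simp add: order_aut_group_def)
  then show ?thesis
    by (simp only: algebra_auts_def mem_Collect_eq Int_iff D order_filtration_eq conj_assoc)
qed

definition conjugate :: "('a \<Rightarrow> 'a) \<Rightarrow> ('a \<Rightarrow> 'a) \<Rightarrow> 'a \<Rightarrow> 'a" where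
  "conjugate \<tau> f = \<tau> \<circ> f \<circ> inv_into UNIV \<tau>"

lemma inv_poly_aut:
  assumes "\<tau> \<in> algebra_auts (poly_algebra TYPE('n::finite) TYPE('k::field))"
  shows "inv_into UNIV \<tau> \<in> algebra_auts (poly_algebra TYPE('n) TYPE('k))"
proof -
  from assms have \<tau>: "bij \<tau>" "\<tau> 1 = 1" "\<And>r s. \<tau> (r + s) = \<tau> r + \<tau> s" "\<And>r s. \<tau> (r * s) = \<tau> r * \<tau> s"
    "\<And>c r. \<tau> (pscale c r) = pscale c (\<tau> r)" by (auto simp: poly_aut_iff)
  have eq: "inv_into UNIV \<tau> x = y" if "\<tau> y = x" for x y using that \<tau>(1) by (metis bij_inv_eq_iff)
  have r: "\<tau> (inv_into UNIV \<tau> x) = x" for x using \<tau>(1) by (simp add: bij_is_surj surj_f_inv_f)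
  show ?thesis unfolding poly_aut_iff
    by (intro conjI allI bij_imp_bij_inv \<tau>(1); rule eq) (simp_all add: \<tau> r)
qed

text \<open>
  The reason is \<open>[\<tau> f \<tau>\<^sup>-\<^sup>1, r] = \<tau> [f, \<tau>\<^sup>-\<^sup>1(r)] \<tau>\<^sup>-\<^sup>1\<close>.
\<close>

lemma conjugate_diff_ops_upto:
  assumes "\<tau> \<in> algebra_auts (poly_algebra TYPE('n::finite) TYPE('k::field))"
  shows "f \<in> diff_ops_upto i \<Longrightarrow> conjugate \<tau> f \<in> diff_ops_upto i"
proof (induction i arbitrary: f)
  from assms have \<tau>: "bij \<tau>" "\<And>r s. \<tau> (r + s) = \<tau> r + \<tau> s" "\<And>r s. \<tau> (r * s) = \<tau> r * \<tau> s"
    "\<And>c r. \<tau> (pscale c r) = pscale c (\<tau> r)" by (auto simp: poly_aut_iff)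
  from inv_poly_aut[OF assms] have \<tau>': "\<And>r s. inv_into UNIV \<tau> (r + s) = inv_into UNIV \<tau> r + inv_into UNIV \<tau> s"
    "\<And>r s. inv_into UNIV \<tau> (r * s) = inv_into UNIV \<tau> r * inv_into UNIV \<tau> s"
    "\<And>c r. inv_into UNIV \<tau> (pscale c r) = pscale c (inv_into UNIV \<tau> r)" by (auto simp: poly_aut_iff)
  have \<tau>_diff: "\<tau> (r - s) = \<tau> r - \<tau> s" for r s using \<tau>(2) by (metis add_diff_cancel diff_add_cancel)
  then have \<tau>_0: "\<tau> 0 = 0" by (metis diff_self)
  have r: "\<tau> (inv_into UNIV \<tau> x) = x" for x using \<tau>(1) by (simp add: bij_is_surj surj_f_inv_f)
  have comm: "mult_commutator (conjugate \<tau> f) r = conjugate \<tau> (mult_commutator f (inv_into UNIV \<tau> r))" for f r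
    by (simp add: mult_commutator_def conjugate_def fun_eq_iff \<tau> \<tau>' \<tau>_diff r)
  have lin: "Vector_Spaces.linear pscale pscale (conjugate \<tau> f)" if "Vector_Spaces.linear pscale pscale f" for f
    using that by (simp add: linear_pscale_iff conjugate_def \<tau> \<tau>')
  have zero: "conjugate \<tau> (\<lambda>_. 0) = (\<lambda>_. 0)" by (simp add: conjugate_def fun_eq_iff \<tau>_0)
  {
    case 0
    then show ?case by (simp add: comm lin zero)
  next
    case (Suc i)
    then show ?case by (simp add: comm lin)
  }
qed

lemma conjugate_inverse:
  assumes "bij \<tau>"
  shows "conjugate \<tau> (conjugate (inv_into UNIV \<tau>) f) = f" "conjugate (inv_into UNIV \<tau>) (conjugate \<tau> f) = f"
  using assms by (simp_all add: conjugate_def fun_eq_iff inv_inv_eq bij_is_inj bij_is_surj surj_f_inv_f)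

lemma conjugate_mult:
  assumes "\<tau> \<in> algebra_auts (poly_algebra TYPE('n::finite) TYPE('k::field))"
  shows "conjugate \<tau> ((*) r) = (*) (\<tau> r)"
  using assms by (simp add: conjugate_def fun_eq_iff poly_aut_iff bij_is_surj surj_f_inv_f)

lemma conjugation_order_aut:
  assumes t: "\<tau> \<in> algebra_auts (poly_algebra TYPE('n::finite) TYPE('k::field))"
  shows "restrict (conjugate \<tau>) diff_ops \<in> carrier (order_aut_group TYPE('n) TYPE('k))"
proof -
  let ?c = "restrict (conjugate \<tau>) diff_ops"
  from t have \<tau>: "bij \<tau>" "\<And>r s. \<tau> (r + s) = \<tau> r + \<tau> s" "\<And>c r. \<tau> (pscale c r) = pscale c (\<tau> r)"
    by (auto simp: poly_aut_iff)
  note closed = conjugate_diff_ops_upto[OF t] conjugate_diff_ops_upto[OF inv_poly_aut[OF t]]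
  \<comment> \<open>Equality rather than inclusion holds because conjugation by the inverse preserves the order, too.\<close>
  have up: "conjugate \<tau> ` diff_ops_upto i = diff_ops_upto i" for i
    using closed by (auto simp: image_iff) (metis conjugate_inverse(1)[OF \<tau>(1)])
  then have im: "conjugate \<tau> ` diff_ops = diff_ops" unfolding diff_ops_def image_UN by simp
  have sub: "diff_ops_upto i \<subseteq> diff_ops" for i :: nat by (auto simp: diff_ops_def)
  have "bij_betw (conjugate \<tau>) diff_ops diff_ops"
    unfolding bij_betw_def using im by (metis conjugate_inverse(2)[OF \<tau>(1)] inj_onI)
  then have bij: "?c \<in> Bij diff_ops" by (simp add: Bij_def)
  have "conjugate \<tau> f \<in> diff_ops" if "f \<in> diff_ops" for f using im that by blast
  then have hom: "?c \<in> ring_hom (diff_op_algebra TYPE('n) TYPE('k)) (diff_op_algebra TYPE('n) TYPE('k))"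
    using \<tau>
    by (intro ring_hom_memI)
      (auto simp: diff_op_algebra_def diff_ops_comp diff_ops_add id_diff_ops conjugate_def fun_eq_iff
        bij_is_inj bij_is_surj surj_f_inv_f)
  have "?c ` diff_ops_upto i = diff_ops_upto i" for i
    using sub[of i] by (subst (2) up[symmetric]) (auto intro!: image_cong)
  moreover have "?c (\<lambda>x. pscale c (f x)) = (\<lambda>x. pscale c (?c f x))" if "f \<in> diff_ops" for c f
    using that \<tau>(3) diff_ops_pscale[OF that] by (simp add: conjugate_def fun_eq_iff)
  ultimately show ?thesis
    using bij hom unfolding order_aut_iff by blast
qed

text \<open>
  The polynomial by which \<open>\<sigma>\<close> of the multiplication by \<open>r\<close> multiplies is recovered as its value
  at \<open>1\<close>; \<open>order_aut_mult\<close> shows that \<open>\<sigma>\<close> indeed yields a multiplication.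
\<close>

definition poly_restriction ::
  "((('n::finite, 'k::field) mpoly \<Rightarrow> ('n, 'k) mpoly) \<Rightarrow> (('n, 'k) mpoly \<Rightarrow> ('n, 'k) mpoly)) \<Rightarrow>
     ('n, 'k) mpoly \<Rightarrow> ('n, 'k) mpoly" where
  "poly_restriction \<sigma> r = \<sigma> ((*) r) 1"

lemma order_aut_mult:
  assumes "\<sigma> \<in> carrier (order_aut_group TYPE('n::finite) TYPE('k::field))"
  shows "\<sigma> ((*) r) = (*) (poly_restriction \<sigma> r)"
proof -
  have "\<sigma> ` range (*) = range (*)"
    using assms unfolding order_aut_iff diff_ops_upto_0[symmetric] by blast
  then obtain s where "\<sigma> ((*) r) = (*) s" by blast
  then show ?thesis by (simp add: poly_restriction_def)
qed

lemma poly_restriction_aut: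
  assumes s: "\<sigma> \<in> carrier (order_aut_group TYPE('n::finite) TYPE('k::field))"
  shows "poly_restriction \<sigma> \<in> algebra_auts (poly_algebra TYPE('n) TYPE('k))"
proof -
  let ?\<tau> = "poly_restriction \<sigma>"
  from s have hom: "\<sigma> \<in> ring_hom (diff_op_algebra TYPE('n) TYPE('k)) (diff_op_algebra TYPE('n) TYPE('k))"
    unfolding order_aut_iff by blast
  interpret diff_op_hom \<sigma> using hom by (rule diff_op_hom.intro)
  have mult_inj: "r = s" if "(*) r = ((*) s :: ('n, 'k) mpoly \<Rightarrow> _)" for r s
    using fun_cong[OF that, of 1] by simp
  have inj: "inj_on \<sigma> diff_ops"
    using s unfolding order_aut_iff Bij_def bij_betw_def by blast
  have smult: "\<sigma> (\<lambda>x. pscale c (f x)) = (\<lambda>x. pscale c (\<sigma> f x))" if "f \<in> diff_ops" for c f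
    using s that unfolding order_aut_iff by blast
  have im: "\<sigma> ` range (*) = range (*)"
    using s unfolding order_aut_iff diff_ops_upto_0[symmetric] by blast
  have "bij ?\<tau>"
  proof (rule bijI)
    show "inj ?\<tau>"
      by (rule injI) (metis order_aut_mult[OF s] inj_onD[OF inj] mult_diff_ops mult_inj)
    show "surj ?\<tau>"
    unfolding surj_def
    proof
      fix t
      have "(*) t \<in> \<sigma> ` range (*)" using im by simp
      then obtain r where "(*) t = \<sigma> ((*) r)" by blast
      then show "\<exists>r. t = ?\<tau> r" using order_aut_mult[OF s] mult_inj by metis
    qed
  qed
  moreover have "?\<tau> 1 = 1"
  proof -
    have "(*) 1 = (id :: ('n, 'k) mpoly \<Rightarrow> _)" by (simp add: fun_eq_iff)
    then show ?thesis by (simp add: poly_restriction_def hom_id)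
  qed
  moreover have "?\<tau> (r + t) = ?\<tau> r + ?\<tau> t" for r t
    using hom_add[OF mult_diff_ops mult_diff_ops, of r t]
    by (simp add: poly_restriction_def flip: distrib_right)
  moreover have "?\<tau> (r * t) = ?\<tau> r * ?\<tau> t" for r t
  proof -
    have "(*) (r * t) = (*) r \<circ> (*) t" by (simp add: fun_eq_iff mult.assoc)
    then have "\<sigma> ((*) (r * t)) = (*) (?\<tau> r) \<circ> (*) (?\<tau> t)"
      by (simp only: hom_comp mult_diff_ops order_aut_mult[OF s])
    then show ?thesis by (simp add: poly_restriction_def)
  qed
  moreover have "?\<tau> (pscale c r) = pscale c (?\<tau> r)" for c r
  proof -
    have "(*) (pscale c r) = (\<lambda>x. pscale c (r * x))" by (simp add: pscale_def fun_eq_iff mult.assoc)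
    then show ?thesis using smult[OF mult_diff_ops, of c r] by (simp add: poly_restriction_def)
  qed
  ultimately show ?thesis by (simp add: poly_aut_iff)
qed

theorem corollary1p2:
  fixes p :: nat
  assumes "CHAR('k::field) = p" and "p > 0"
  shows "order_aut_group TYPE('n::finite) TYPE('k) \<cong> algebra_aut_group (poly_algebra TYPE('n) TYPE('k))"
proof -
  let ?G = "order_aut_group TYPE('n) TYPE('k)"
  let ?H = "algebra_aut_group (poly_algebra TYPE('n) TYPE('k))"
  let ?R = "poly_restriction :: _ \<Rightarrow> ('n, 'k) mpoly \<Rightarrow> ('n, 'k) mpoly"
  have carrier_H: "carrier ?H = algebra_auts (poly_algebra TYPE('n) TYPE('k))"
    by (simp add: algebra_aut_group_def)
  have carrier_D: "carrier (diff_op_algebra TYPE('n) TYPE('k)) = diff_ops"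
    by (simp add: diff_op_algebra_def)
  have Bij_G: "\<sigma> \<in> Bij diff_ops" if "\<sigma> \<in> carrier ?G" for \<sigma>
    using that unfolding order_aut_iff by blast
  have mult_G: "\<sigma> \<otimes>\<^bsub>?G\<^esub> \<sigma>' = compose diff_ops \<sigma> \<sigma>'" if "\<sigma> \<in> carrier ?G" "\<sigma>' \<in> carrier ?G" for \<sigma> \<sigma>'
    using that[THEN Bij_G] by (simp add: order_aut_group_def algebra_aut_group_def BijGroup_def carrier_D)
  have one_G: "\<one>\<^bsub>?G\<^esub> = restrict id diff_ops"
    by (simp add: order_aut_group_def algebra_aut_group_def BijGroup_def carrier_D id_def)
  have mult_H: "\<tau> \<otimes>\<^bsub>?H\<^esub> \<tau>' = \<tau> \<circ> \<tau>'" if "\<tau> \<in> carrier ?H" "\<tau>' \<in> carrier ?H" for \<tau> \<tau>'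
    using that by (auto simp: algebra_aut_group_def BijGroup_def algebra_auts_def poly_algebra_def compose_def)
  have one_H: "\<one>\<^bsub>?H\<^esub> = id"
    by (simp add: algebra_aut_group_def BijGroup_def poly_algebra_def id_def restrict_def)
  \<comment> \<open>For a homomorphism of groups, injectivity reduces to the kernel, where rigidity applies.\<close>
  interpret group_hom ?G ?H ?R
  proof (intro group_hom.intro group_hom_axioms.intro group_order_aut_group group_poly_auts homI)
    fix \<sigma> \<sigma>' assume s: "\<sigma> \<in> carrier ?G" "\<sigma>' \<in> carrier ?G"
    then show "?R (\<sigma> \<otimes>\<^bsub>?G\<^esub> \<sigma>') = ?R \<sigma> \<otimes>\<^bsub>?H\<^esub> ?R \<sigma>'"
      by (subst mult_H)
        (auto simp: mult_G carrier_H poly_restriction_aut fun_eq_iff poly_restriction_def[of "compose _ _ _"]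
          compose_eq mult_diff_ops order_aut_mult)
  qed (simp add: carrier_H poly_restriction_aut)
  have "?R \<in> iso ?G ?H"
    unfolding iso_iff
  proof (intro conjI ballI impI)
    show "carrier ?H \<subseteq> ?R ` carrier ?G"
    proof
      fix \<tau> assume t: "\<tau> \<in> carrier ?H"
      have "?R (restrict (conjugate \<tau>) diff_ops) = \<tau>"
        using conjugate_mult[of \<tau>] t by (simp add: poly_restriction_def fun_eq_iff carrier_H mult_diff_ops)
      then show "\<tau> \<in> ?R ` carrier ?G"
        using conjugation_order_aut[of \<tau>] t by (force simp: carrier_H)
    qed
  next
    fix \<sigma> assume s: "\<sigma> \<in> carrier ?G" and one: "?R \<sigma> = \<one>\<^bsub>?H\<^esub>"
    interpret diff_op_hom_fixing_mult \<sigma>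
    proof
      show "\<sigma> \<in> ring_hom (diff_op_algebra TYPE('n) TYPE('k)) (diff_op_algebra TYPE('n) TYPE('k))"
        using s unfolding order_aut_iff by blast
      show "\<sigma> ((*) r) = (*) r" for r
        using order_aut_mult[OF s, of r] one by (simp add: one_H)
    qed
    have "\<sigma> \<in> extensional diff_ops" using Bij_G[OF s] by (rule Bij_imp_extensional)
    then show "\<sigma> = \<one>\<^bsub>?G\<^esub>"
      unfolding one_G using rigidity assms by (intro extensionalityI[of _ diff_ops]) auto
  qed
  then show ?thesis by (auto simp: is_iso_def)
qed

end
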